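(* Let $a>0$, $b\in\mathbb{R}$, $c>0$, let $k_{a,b,c}$ be the density of the Kummer distribution $K(a,b,c)$, let $W\sim K(a,b,c)$, let $s(x)=x(1+x)$, and let $h$ be a bounded real-valued function on $(0,\infty)$. Then the equation $$x(x+1)f'(x)+\left[(1-b)x-cx(1+x)+a\right]f(x)=h(x)-\mathbb{E}\,h(W),\qquad x>0,$$ has solution $$f_h(x)=\frac{1}{s(x)k_{a,b,c}(x)}\int_0^x k_{a,b,c}(t)\left[h(t)-\mathbb{E}\,h(W)\right]dt=\frac{-1}{s(x)k_{a,b,c}(x)}\int_x^{+\infty}k_{a,b,c}(t)\left[h(t)-\mathbb{E}\,h(W)\right]dt,\qquad x>0.$$ Moreover, if $h$ is a bounded continuous function and $1-b-c\le 0$, then $f_h$ is the unique bounded solution of this equation, and $$\|f_h\|\le M\,\|h(\cdot)-\mathbb{E}\,h(W)\|,$$ where $$\alpha=\frac{1-b-c+\sqrt{(1-b-c)^2+4ac}}{2c},\qquad M=\max\left(\frac{1}{s(\alpha)k_{a,b,c}(\alpha)}\int_0^\alpha k_{a,b,c}(t)\,dt\,;\ \frac{1}{s(\alpha)k_{a,b,c}(\alpha)}\int_\alpha^{+\infty}k_{a,b,c}(t)\,dt\right).$$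
   Context: For $a>0$, $b\in\mathbb{R}$, $c>0$, the Kummer distribution $K(a,b,c)$ is the distribution on $(0,\infty)$ with density $$k_{a,b,c}(x)=\frac{1}{\Gamma(a)\psi(a,a-b+1;c)}\,x^{a-1}(1+x)^{-a-b}e^{-cx},\qquad x>0,$$ where $\psi$ is the confluent hypergeometric function of the second kind (so the prefactor is the normalizing constant). For a function $u$ on $(0,\infty)$, $\|u\|=\sup_{x>0}|u(x)|$.
   Formalization: The normalizing constant is corrected to Γ(a)ψ(a,1-b;c). For h merely bounded (and Borel measurable), f_h is a locally absolutely continuous solution: the equation holds for almost every x>0 and at each continuity point of h, since it fails at jumps of h. *)

theory Defs
  imports "HOL-Probability.Probability"
begin

text \<open>
  The confluent hypergeometric function of the second kind $\psi(a,b;z)$ (Tricomi's function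
  $U(a,b,z)$), given by its classical integral representation. This is meaningful for
  $a > 0$ and $z > 0$, the only range in which it is used below.
\<close>

definition tricomi :: "real \<Rightarrow> real \<Rightarrow> real \<Rightarrow> real" where
  "tricomi a b z =
     1 / Gamma a * (LBINT t:{0<..}. t powr (a - 1) * (1 + t) powr (b - a - 1) * exp (- z * t))"

text \<open>
  With the exponent $-a-b$ of $1+x$, the normalizing constant is $\Gamma(a)\psi(a,1-b;c)$. The
  second parameter $a-b+1$ that is sometimes printed here belongs to the other common
  parametrization, in which the density is proportional to $x^{a-1}(1+x)^{-b}e^{-cx}$.
\<close>

definition kummer_density :: "real \<Rightarrow> real \<Rightarrow> real \<Rightarrow> real \<Rightarrow> real" where
  "kummer_density a b c x =
     (if 0 < x
      then 1 / (Gamma a * tricomi a (1 - b) c) * (x powr (a - 1) * (1 + x) powr (- a - b) * exp (- c * x))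
      else 0)"

lemma kummer_kernel_integrable:
  fixes a b c :: real
  assumes "0 < a" "0 < c"
  shows "set_integrable lborel {0<..} (\<lambda>t. t powr (a - 1) * (1 + t) powr b * exp (- c * t))"
proof -
  define d where "d = c / 2"
  define p where "p = max 1 b"
  have d: "d > 0" and p: "p \<ge> 1" "b \<le> p" using assms by (auto simp: d_def p_def)
  have bd: "(1 + t) powr b \<le> exp d * (p / d) powr p * exp (d * t)" if "t > 0" for t :: real
  proof -
    have "(1 + t) powr b \<le> (1 + t) powr p" using that p by (intro powr_mono) auto
    also have "\<dots> = (p / d * (d * (1 + t) / p)) powr p" using d p by simp
    also have "\<dots> = (p / d) powr p * (d * (1 + t) / p) powr p"
      by (rule powr_mult)
    also have "(d * (1 + t) / p) powr p \<le> exp (d * (1 + t) / p) powr p"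
      using d p that exp_ge_add_one_self[of "d * (1 + t) / p"] by (intro powr_mono2) (auto simp del: exp_ge_add_one_self)
    also have "\<dots> = exp (d + d * t)" using p by (simp add: exp_powr_real field_simps)
    finally show ?thesis using d p by (simp add: exp_add mult_ac mult_left_mono)
  qed
  have "(\<lambda>t. complex_of_real t powr (of_real a - 1) / of_real (exp (d * t))) absolutely_integrable_on {0<..}"
    using absolutely_integrable_Gamma_integral[of "of_real a" d] assms d by simp
  hence "(\<lambda>t. norm (complex_of_real t powr (of_real a - 1) / of_real (exp (d * t)))) absolutely_integrable_on {0<..}"
    by (rule absolutely_integrable_norm[unfolded comp_def])
  hence "(\<lambda>t. t powr (a - 1) * exp (- d * t)) absolutely_integrable_on {0<..}"
    by (rule set_integrable_cong[THEN iffD1, rotated -1])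
       (auto simp: norm_divide norm_powr_real_powr exp_minus field_simps)
  hence "set_integrable lborel {0<..} (\<lambda>t. t powr (a - 1) * exp (- d * t))"
    unfolding set_integrable_def by (subst (asm) integrable_completion) auto
  hence "set_integrable lborel {0<..} (\<lambda>t. exp d * (p / d) powr p * (t powr (a - 1) * exp (- d * t)))"
    by (intro set_integrable_mult_right) auto
  thus ?thesis
  proof (rule set_integrable_bound)
    show "set_borel_measurable lborel {0<..} (\<lambda>t. t powr (a - 1) * (1 + t) powr b * exp (- c * t))"
      unfolding set_borel_measurable_def by measurable
    show "AE t in lborel. t \<in> {0<..} \<longrightarrow> norm (t powr (a - 1) * (1 + t) powr b * exp (- c * t))
        \<le> norm (exp d * (p / d) powr p * (t powr (a - 1) * exp (- d * t)))"
    proof (rule AE_I2, rule impI)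
      fix t :: real assume "t \<in> {0<..}"
      hence t: "t > 0" by simp
      define L where "L = t powr (a - 1) * (1 + t) powr b * exp (- c * t)"
      have "L \<le> t powr (a - 1) * (exp d * (p / d) powr p * exp (d * t)) * exp (- c * t)"
        unfolding L_def using bd[OF t] by (intro mult_right_mono mult_left_mono) auto
      also have "exp (- c * t) = exp (- d * t) * exp (- d * t)"
        by (simp add: d_def field_simps flip: exp_add)
      also have "t powr (a - 1) * (exp d * (p / d) powr p * exp (d * t)) * (exp (- d * t) * exp (- d * t))
          = exp d * (p / d) powr p * (t powr (a - 1) * exp (- d * t)) * (exp (d * t) * exp (- d * t))"
        by (simp only: mult_ac)
      also have "exp (d * t) * exp (- d * t) = 1" by (simp flip: exp_add)
      finally show "norm (t powr (a - 1) * (1 + t) powr b * exp (- c * t))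
        \<le> norm (exp d * (p / d) powr p * (t powr (a - 1) * exp (- d * t)))"
        by (simp add: L_def)
    qed
  qed
qed

lemma kummer_density_prob_space:
  fixes a b c :: real
  assumes "0 < a" "0 < c"
  shows "prob_space (density (restrict_space lborel {0<..}) (\<lambda>x. ennreal (kummer_density a b c x)))"
proof -
  define q where "q = (\<lambda>t. t powr (a - 1) * (1 + t) powr (- a - b) * exp (- c * t))"
  define I where "I = (LBINT t:{0<..}. q t)"
  have q: "set_integrable lborel {0<..} q"
    unfolding q_def using kummer_kernel_integrable[OF assms] .
  have "I > 0"
  proof -
    have "emeasure lborel {x \<in> {0<..}. indicator {0<..} x *\<^sub>R q x \<noteq> 0} \<noteq> 0"
    proof -
      have "emeasure lborel {1..2::real} \<le> emeasure lborel {x \<in> {0<..}. indicator {0<..} x *\<^sub>R q x \<noteq> 0}"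
        unfolding q_def by (intro emeasure_mono) (auto simp: indicator_def)
      thus ?thesis by (auto simp: )
    qed
    hence "\<not> (AE x in lborel. indicator {0<..} x *\<^sub>R q x = 0)"
      by (subst AE_iff_measurable[OF _ refl]) (auto simp: q_def indicator_def cong: conj_cong)
    hence "integral\<^sup>L lborel (\<lambda>x. indicator {0<..} x *\<^sub>R q x) \<noteq> 0"
      using q unfolding set_integrable_def
      by (subst integral_nonneg_eq_0_iff_AE) (auto simp: q_def indicator_def)
    moreover have "integral\<^sup>L lborel (\<lambda>x. indicator {0<..} x *\<^sub>R q x) \<ge> 0"
      by (intro integral_nonneg_AE) (auto simp: q_def indicator_def)
    ultimately show ?thesis by (simp add: I_def set_lebesgue_integral_def)
  qed
  have G: "Gamma a * tricomi a (1 - b) c = I"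
  proof -
    have e: "1 - b - a - 1 = - a - b" by simp
    show ?thesis unfolding tricomi_def e using Gamma_real_pos[OF assms(1)] by (simp add: I_def q_def)
  qed
  have k: "kummer_density a b c x = q x / I" if "x > 0" for x
    using that G by (simp add: kummer_density_def q_def)
  have "(\<integral>\<^sup>+x. ennreal (kummer_density a b c x) \<partial>restrict_space lborel {0<..})
      = (\<integral>\<^sup>+x. ennreal (indicator {0<..} x *\<^sub>R q x / I) \<partial>lborel)"
    by (subst nn_integral_restrict_space) (auto intro!: nn_integral_cong simp: k indicator_def)
  also have "\<dots> = ennreal (\<integral>x. indicator {0<..} x *\<^sub>R q x / I \<partial>lborel)"
    using q \<open>I > 0\<close> unfolding set_integrable_def
    by (intro nn_integral_eq_integral integrable_divide_zero) (auto simp: q_def indicator_def)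
  also have "\<dots> = 1"
    using \<open>I > 0\<close> by (simp add: I_def set_lebesgue_integral_def)
  finally have *: "(\<integral>\<^sup>+x. ennreal (kummer_density a b c x) \<partial>restrict_space lborel {0<..}) = 1" .
  have "(\<lambda>x. ennreal (kummer_density a b c x)) \<in> borel_measurable (restrict_space lborel {0<..})"
    unfolding kummer_density_def by (intro measurable_restrict_space1) measurable
  hence "emeasure (density (restrict_space lborel {0<..}) (\<lambda>x. ennreal (kummer_density a b c x)))
      (space (restrict_space lborel {0<..})) = 1"
    using * nn_integral_cong[of "restrict_space lborel {0<..}"
        "\<lambda>x. ennreal (kummer_density a b c x) * indicator (space (restrict_space lborel {0<..})) x"
        "\<lambda>x. ennreal (kummer_density a b c x)"]
    by (subst emeasure_density) (simp_all add: sets_restrict_space_iff)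
  thus ?thesis by (intro prob_spaceI) simp
qed
text \<open>
  $W \sim K(a,b,c)$: the target measurable space is the half-line, so $W$ takes values in
  $(0,\infty)$ and functions on $(0,\infty)$ may be composed with it, whatever the value of their
  (irrelevant) extensions to the other reals.
\<close>

definition kummer_distributed ::
    "'w measure \<Rightarrow> ('w \<Rightarrow> real) \<Rightarrow> real \<Rightarrow> real \<Rightarrow> real \<Rightarrow> bool" where
  "kummer_distributed P W a b c \<longleftrightarrow>
     distributed P (restrict_space lborel {0<..}) W (\<lambda>x. ennreal (kummer_density a b c x))"

definition sup_norm :: "(real \<Rightarrow> real) \<Rightarrow> real" where
  "sup_norm u = (SUP x\<in>{0<..}. \<bar>u x\<bar>)"

definition stein_s :: "real \<Rightarrow> real" where
  "stein_s x = x * (1 + x)"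

definition stein_eq_at ::
    "real \<Rightarrow> real \<Rightarrow> real \<Rightarrow> (real \<Rightarrow> real) \<Rightarrow> (real \<Rightarrow> real) \<Rightarrow> real \<Rightarrow> bool" where
  "stein_eq_at a b c g f x \<longleftrightarrow>
     (\<exists>D. (f has_real_derivative D) (at x) \<and>
          x * (x + 1) * D + ((1 - b) * x - c * x * (1 + x) + a) * f x = g x)"

definition stein_sol :: "real \<Rightarrow> real \<Rightarrow> real \<Rightarrow> (real \<Rightarrow> real) \<Rightarrow> real \<Rightarrow> real" where
  "stein_sol a b c g x =
     1 / (stein_s x * kummer_density a b c x) * (LBINT t:{0<..<x}. kummer_density a b c t * g t)"

definition abs_continuous_on :: "real set \<Rightarrow> (real \<Rightarrow> real) \<Rightarrow> bool" where
  "abs_continuous_on S f \<longleftrightarrow>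
     (\<forall>\<epsilon>>0. \<exists>\<delta>>0. \<forall>I :: (real \<times> real) set.
        finite I \<and> (\<forall>(p, q)\<in>I. p \<le> q \<and> {p..q} \<subseteq> S) \<and>
        pairwise (\<lambda>(p, q) (p', q'). disjnt {p<..<q} {p'<..<q'}) I \<and>
        (\<Sum>(p, q)\<in>I. q - p) < \<delta>
        \<longrightarrow> (\<Sum>(p, q)\<in>I. \<bar>f q - f p\<bar>) < \<epsilon>)"

text \<open>
  For a right-hand side that is bounded but not continuous, the differential equation cannot hold
  at every point (at a jump of the right-hand side there is no two-sided derivative), so a solution
  is understood in the sense of Caratheodory: locally absolutely continuous on $(0,\infty)$,
  satisfying the equation almost everywhere. For a continuous right-hand side the classical notion
  is used.
\<close>

definition caratheodory_solution ::
    "real \<Rightarrow> real \<Rightarrow> real \<Rightarrow> (real \<Rightarrow> real) \<Rightarrow> (real \<Rightarrow> real) \<Rightarrow> bool" where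
  "caratheodory_solution a b c g f \<longleftrightarrow>
     (\<forall>u v. 0 < u \<longrightarrow> abs_continuous_on {u..v} f) \<and>
     (AE x in lborel. 0 < x \<longrightarrow> stein_eq_at a b c g f x)"

definition classical_solution ::
    "real \<Rightarrow> real \<Rightarrow> real \<Rightarrow> (real \<Rightarrow> real) \<Rightarrow> (real \<Rightarrow> real) \<Rightarrow> bool" where
  "classical_solution a b c g f \<longleftrightarrow> (\<forall>x>0. stein_eq_at a b c g f x)"

definition stein_alpha :: "real \<Rightarrow> real \<Rightarrow> real \<Rightarrow> real" where
  "stein_alpha a b c = (1 - b - c + sqrt ((1 - b - c)\<^sup>2 + 4 * a * c)) / (2 * c)"

definition stein_M :: "real \<Rightarrow> real \<Rightarrow> real \<Rightarrow> real" where
  "stein_M a b c =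
     (let \<alpha> = stein_alpha a b c; C = 1 / (stein_s \<alpha> * kummer_density a b c \<alpha>) in
      max (C * (LBINT t:{0<..<\<alpha>}. kummer_density a b c t))
          (C * (LBINT t:{\<alpha><..}. kummer_density a b c t)))"

end

theory Submission
  imports Defs "HOL-Real_Asymp.Real_Asymp"
begin

text \<open>
  Write $k$ for the Kummer density, $s(x) = x(1+x)$, $p = s\,k$ and
  $T(x) = (1-b)x - cx(1+x) + a$. Differentiating the logarithm of
  $p(x) = C x^a (1+x)^{1-a-b} e^{-cx}$ gives $p' = kT$, so $p$ is an integrating factor: the equation
  $s f' + T f = g$ is equivalent to $(pf)' = kg$. Hence $f_h(x) = p(x)^{-1}\int_0^x kg$ is a solution
  wherever the integral has the derivative $k(x)g(x)$: at every continuity point of $h$, and almost everywhere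
  by Lebesgue's differentiation theorem (\<open>AE_DERIV_set_integral_atMost\<close>). The second formula for
  $f_h$ holds because $\int_0^\infty kg = \mathbb{E}\,h(W) - \mathbb{E}\,h(W) = 0$.

  Uniqueness (\<open>bounded_solution_unique\<close>): on $(0,\infty)$ every solution $f$ satisfies
  $p(x)f(x) = e + \int_0^x kg$ with a constant $e$, and if $f$ is bounded, then $e = 0$ because $p$ vanishes
  at 0.

  The norm bound: let $K(x) = \int_0^x k$. Then $|f_h|$ is at most $\|g\|\,K/p$ and also at most
  $\|g\|\,(1-K)/p$. If $1-b-c \le 0$, then $T$ is decreasing on $(0,\infty)$, hence
  $p(x) = \int_0^x kT \ge T(x)K(x)$ and $p(x) = -\int_x^\infty kT \ge -T(x)(1-K(x))$. These two
  inequalities say exactly that $K/p$ is nondecreasing and $(1-K)/p$ nonincreasing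
  (\<open>kummer_cdf_ratio_mono\<close> and \<open>kummer_tail_ratio_antimono\<close>). Using the
  first bound on $(0,\alpha]$ and the second one on $[\alpha,\infty)$, the supremum is controlled by the
  larger of the two ratios at $\alpha$, which is $M$.
\<close>

section \<open>Indefinite integrals on the real line\<close>

lemma lborel_integrable_imp_integrable_on:
  fixes u :: "real \<Rightarrow> real"
  assumes "integrable lborel u"
  shows "u integrable_on {x..y}"
  by (metis assms integrable_on_lborel integrable_on_subinterval top_greatest)

text \<open>
  Increments of an indefinite Lebesgue integral are Henstock--Kurzweil integrals over compact
  intervals, which gives access to the continuity and differentiability theorems about the latter.
\<close>

lemma diff_set_integral_atMost_eq_integral:
  fixes u :: "real \<Rightarrow> real"
  assumes u: "integrable lborel u" and "x \<le> y"
  shows "(LBINT t:{..y}. u t) - (LBINT t:{..x}. u t) = integral {x..y} u"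
proof -
  have i: "set_integrable lborel A u" if "A \<in> sets borel" for A
    using u that unfolding set_integrable_def by (intro integrable_mult_indicator) auto
  have eq: "{..y} = {..x} \<union> {x<..y}" using \<open>x \<le> y\<close> by auto
  have "(LBINT t:{..y}. u t) = (LBINT t:{..x}. u t) + (LBINT t:{x<..y}. u t)"
    unfolding eq by (rule set_integral_Un) (auto intro: i)
  also have "(LBINT t:{x<..y}. u t) = (LBINT t:{x..y}. u t)"
  proof (rule set_integral_null_delta[OF u])
    have "sym_diff {x<..y} {x..y} \<subseteq> {x}" by auto
    thus "sym_diff {x<..y} {x..y} \<in> null_sets lborel"
      by (rule null_sets_subset[rotated 2]) auto
  qed auto
  also have "\<dots> = integral {x..y} u"
    by (intro set_borel_integral_eq_integral i) auto
  finally show ?thesis by simp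
qed

lemma set_integral_greaterThan_eq:
  fixes u :: "real \<Rightarrow> real"
  assumes u: "integrable lborel u"
  shows "(LBINT t:{x<..}. u t) = (LBINT t. u t) - (LBINT t:{..x}. u t)"
proof -
  have i: "set_integrable lborel A u" if "A \<in> sets borel" for A
    using u that unfolding set_integrable_def by (intro integrable_mult_indicator) auto
  have "{..x} \<union> {x<..} = UNIV" by auto
  hence "(LBINT t. u t) = (LBINT t:{..x} \<union> {x<..}. u t)"
    by (simp add: set_lebesgue_integral_def)
  also have "\<dots> = (LBINT t:{..x}. u t) + (LBINT t:{x<..}. u t)"
    by (rule set_integral_Un) (auto intro: i)
  finally show ?thesis by simp
qed

lemma lipschitz_on_set_integral_atMost:
  fixes w :: "real \<Rightarrow> real"
  assumes w: "integrable lborel w" and B: "\<And>t. t \<in> {u..v} \<Longrightarrow> \<bar>w t\<bar> \<le> B" and "0 \<le> B"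
  shows "B-lipschitz_on {u..v} (\<lambda>x. LBINT t:{..x}. w t)"
proof (rule lipschitz_on_leI[OF _ \<open>0 \<le> B\<close>])
  fix x y assume xy: "x \<in> {u..v}" "y \<in> {u..v}" "x \<le> y"
  have "norm (integral {x..y} w) \<le> B * measure lborel {x..y}"
    using lborel_integrable_imp_integrable_on[OF w, of x y] \<open>0 \<le> B\<close> B xy
    by (intro has_integral_bound_real[where f = w]) auto
  thus "dist (LBINT t:{..x}. w t) (LBINT t:{..y}. w t) \<le> B * dist x y"
    using diff_set_integral_atMost_eq_integral[OF w xy(3)] xy(3) by (simp add: dist_real_def)
qed

lemma isCont_set_integral_atMost:
  fixes u :: "real \<Rightarrow> real"
  assumes u: "integrable lborel u"
  shows "isCont (\<lambda>x. LBINT t:{..x}. u t) x"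
proof -
  have "continuous_on {x-1..x+1} (\<lambda>y. (LBINT t:{..x-1}. u t) + integral {x-1..y} u)"
    by (intro continuous_intros indefinite_integral_continuous_1 lborel_integrable_imp_integrable_on u)
  hence "continuous_on {x-1..x+1} (\<lambda>x. LBINT t:{..x}. u t)"
    by (rule continuous_on_eq) (use diff_set_integral_atMost_eq_integral[OF u] in force)
  thus ?thesis by (rule continuous_on_interior) auto
qed

lemma DERIV_set_integral_atMost_if_isCont:
  fixes u :: "real \<Rightarrow> real"
  assumes u: "integrable lborel u" and c: "isCont u x"
  shows "((\<lambda>x. LBINT t:{..x}. u t) has_real_derivative u x) (at x)"
proof -
  have "((\<lambda>y. integral {x-1..y} u) has_vector_derivative u x) (at x within {x-1..x+1} - {})"
    by (rule integral_has_vector_derivative_continuous_at)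
       (use c in \<open>auto intro: lborel_integrable_imp_integrable_on u continuous_at_imp_continuous_at_within\<close>)
  hence "((\<lambda>y. integral {x-1..y} u) has_real_derivative u x) (at x)"
    by (simp add: has_real_derivative_iff_has_vector_derivative at_within_Icc_at)
  hence *: "((\<lambda>y. (LBINT t:{..x-1}. u t) + integral {x-1..y} u) has_real_derivative u x) (at x)"
    by (auto intro!: derivative_eq_intros)
  show ?thesis
  proof (rule has_field_derivative_transform_within_open[OF *, where S = "{x-1<..<x+1}"])
    fix y assume "y \<in> {x-1<..<x+1}"
    thus "(LBINT t:{..x-1}. u t) + integral {x-1..y} u = (LBINT t:{..y}. u t)"
      using diff_set_integral_atMost_eq_integral[OF u, of "x-1" y] by simp
  qed auto
qed

text \<open>
  The one-sided half of Lebesgue's differentiation theorem: on the line, the averages over cubes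
  with lower corner \<open>x\<close> in \<open>integrable_ccontinuous_explicit\<close> are the difference
  quotients of the integral from the right.
\<close>

lemma AE_right_difference_quotient_integral:
  fixes u :: "real \<Rightarrow> real"
  assumes u: "integrable lborel u"
  shows "AE x in lborel. ((\<lambda>h. integral {x..x + h} u / h) \<longlongrightarrow> u x) (at_right 0)"
proof -
  obtain N where N: "negligible N" and
    lim: "\<And>x e. \<lbrakk>x \<notin> N; 0 < e\<rbrakk> \<Longrightarrow> \<exists>d>0. \<forall>h. 0 < h \<and> h < d \<longrightarrow>
      norm (integral (cbox x (x + h *\<^sub>R One)) u /\<^sub>R h ^ DIM(real) - u x) < e"
    by (rule integrable_ccontinuous_explicit[of u])
       (use lborel_integrable_imp_integrable_on[OF u] in auto)
  have "AE x in lborel. x \<notin> N"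
    using AE_not_in[of N lebesgue] N by (simp add: negligible_iff_null_sets AE_completion_iff)
  moreover have "((\<lambda>h. integral {x..x + h} u / h) \<longlongrightarrow> u x) (at_right 0)" if "x \<notin> N" for x
  proof (rule tendstoI)
    fix e :: real assume "0 < e"
    from lim[OF that this] obtain d where "d > 0" and
      d: "\<And>h. 0 < h \<Longrightarrow> h < d \<Longrightarrow> \<bar>integral {x..x + h} u / h - u x\<bar> < e"
      by (auto simp: field_simps)
    show "\<forall>\<^sub>F h in at_right 0. dist (integral {x..x + h} u / h) (u x) < e"
      unfolding eventually_at_right_field dist_real_def using \<open>d > 0\<close> d by blast
  qed
  ultimately show ?thesis by (auto elim: eventually_mono)
qed

text \<open>
  Lebesgue's differentiation theorem on the line. The left difference quotients of the integral of
  \<open>u\<close> at \<open>x\<close> are the right difference quotients of the integral of the reflected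
  function at \<open>- x\<close>; since Lebesgue measure is invariant under reflection, both one-sided
  limits exist almost everywhere.
\<close>

lemma AE_DERIV_set_integral_atMost:
  fixes u :: "real \<Rightarrow> real"
  assumes u: "integrable lborel u"
  shows "AE x in lborel. ((\<lambda>x. LBINT t:{..x}. u t) has_real_derivative u x) (at x)"
proof -
  have u': "integrable lborel (\<lambda>t. u (- t))"
    using lborel_integrable_real_affine[OF u, of "-1" 0] by simp
  have "AE x in distr lborel borel uminus.
      ((\<lambda>h. integral {x..x + h} (\<lambda>t. u (- t)) / h) \<longlongrightarrow> u (- x)) (at_right 0)"
    unfolding lborel_distr_uminus by (rule AE_right_difference_quotient_integral[OF u'])
  from AE_distrD[OF _ this]
  have "AE x in lborel. ((\<lambda>h. integral {- x..- x + h} (\<lambda>t. u (- t)) / h) \<longlongrightarrow> u x) (at_right 0)"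
    by simp
  with AE_right_difference_quotient_integral[OF u] show ?thesis
  proof eventually_elim
    fix x
    let ?F = "\<lambda>x. LBINT t:{..x}. u t"
    assume r: "((\<lambda>h. integral {x..x + h} u / h) \<longlongrightarrow> u x) (at_right 0)"
       and l: "((\<lambda>h. integral {- x..- x + h} (\<lambda>t. u (- t)) / h) \<longlongrightarrow> u x) (at_right 0)"
    have "((\<lambda>h. (?F (x + h) - ?F x) / h) \<longlongrightarrow> u x) (at_right 0)"
      by (rule Lim_transform_eventually[OF r])
         (auto simp: eventually_at_right_field diff_set_integral_atMost_eq_integral[OF u] intro!: exI[of _ 1])
    moreover have "((\<lambda>h. (?F (x + h) - ?F x) / h) \<longlongrightarrow> u x) (at_left 0)"
    proof -
      have "((\<lambda>h. (?F (x + - h) - ?F x) / - h) \<longlongrightarrow> u x) (at_right 0)"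
      proof (rule Lim_transform_eventually[OF l])
        show "\<forall>\<^sub>F h in at_right 0. integral {- x..- x + h} (\<lambda>t. u (- t)) / h = (?F (x + - h) - ?F x) / - h"
          unfolding eventually_at_right_field
        proof (intro exI[of _ 1] conjI allI impI)
          fix h :: real assume "0 < h"
          have "?F x - ?F (x - h) = integral {x - h..x} u"
            using \<open>0 < h\<close> by (intro diff_set_integral_atMost_eq_integral u) auto
          also have "\<dots> = integral {- x..- (x - h)} (\<lambda>t. u (- t))"
            using Henstock_Kurzweil_Integration.integral_reflect_real[of x "x - h" u] by simp
          finally show "integral {- x..- x + h} (\<lambda>t. u (- t)) / h = (?F (x + - h) - ?F x) / - h"
            by (simp add: field_simps)
        qed auto
      qed
      thus ?thesis unfolding filterlim_at_left_to_right by simp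
    qed
    ultimately show "(?F has_real_derivative u x) (at x)"
      unfolding DERIV_def by (intro filterlim_split_at)
  qed
qed

section \<open>Lipschitz functions\<close>

text \<open>
  The solution of the Stein equation is even Lipschitz on compact subsets of the half-line, and for
  Lipschitz functions products are easy to handle.
\<close>

lemma lipschitz_imp_abs_continuous_on:
  assumes "L-lipschitz_on S f"
  shows "abs_continuous_on S f"
  unfolding abs_continuous_on_def
proof (intro allI impI)
  fix e :: real assume "e > 0"
  have L: "L \<ge> 0" using assms by (rule lipschitz_on_nonneg)
  show "\<exists>\<delta>>0. \<forall>I. finite I \<and> (\<forall>(p, q)\<in>I. p \<le> q \<and> {p..q} \<subseteq> S) \<and>
        pairwise (\<lambda>(p, q) (p', q'). disjnt {p<..<q} {p'<..<q'}) I \<and> (\<Sum>(p, q)\<in>I. q - p) < \<delta>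
        \<longrightarrow> (\<Sum>(p, q)\<in>I. \<bar>f q - f p\<bar>) < e"
  \<comment> \<open>Adding 1 to \<open>L\<close> covers the case of a constant function.\<close>
  proof (intro exI[of _ "e / (L + 1)"] conjI allI impI; (elim conjE)?)
    show "e / (L + 1) > 0" using \<open>e > 0\<close> L by simp
    fix I :: "(real \<times> real) set"
    assume I: "finite I" "\<forall>(p, q)\<in>I. p \<le> q \<and> {p..q} \<subseteq> S" "(\<Sum>(p, q)\<in>I. q - p) < e / (L + 1)"
    have "(\<Sum>(p, q)\<in>I. \<bar>f q - f p\<bar>) \<le> (\<Sum>(p, q)\<in>I. (L + 1) * (q - p))"
    proof (intro sum_mono, safe)
      fix p q assume "(p, q) \<in> I"
      hence pq: "p \<le> q" "p \<in> S" "q \<in> S" using I(2) by force+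
      have "\<bar>f q - f p\<bar> \<le> L * \<bar>q - p\<bar>"
        using lipschitz_on_normD[OF assms pq(3,2)] by simp
      also have "\<dots> \<le> (L + 1) * (q - p)" using pq L by (simp add: algebra_simps)
      finally show "\<bar>f q - f p\<bar> \<le> (L + 1) * (q - p)" .
    qed
    also have "\<dots> = (L + 1) * (\<Sum>(p, q)\<in>I. q - p)"
      by (simp add: sum_distrib_left case_prod_unfold)
    also have "\<dots> < e" using I(3) L by (simp add: field_simps)
    finally show "(\<Sum>(p, q)\<in>I. \<bar>f q - f p\<bar>) < e" .
  qed
qed

lemma lipschitz_on_mult_bounded:
  fixes f g :: "real \<Rightarrow> real"
  assumes f: "L-lipschitz_on S f" and g: "M-lipschitz_on S g"
    and bf: "\<And>x. x \<in> S \<Longrightarrow> \<bar>f x\<bar> \<le> A" and bg: "\<And>x. x \<in> S \<Longrightarrow> \<bar>g x\<bar> \<le> B" and "0 \<le> A" "0 \<le> B"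
  shows "(A * M + B * L)-lipschitz_on S (\<lambda>x. f x * g x)"
proof (rule lipschitz_onI)
  show "0 \<le> A * M + B * L"
    using lipschitz_on_nonneg[OF f] lipschitz_on_nonneg[OF g] assms by simp
  fix x y assume xy: "x \<in> S" "y \<in> S"
  have "\<bar>f x * g x - f y * g y\<bar> = \<bar>f x * (g x - g y) + g y * (f x - f y)\<bar>"
    by (simp add: algebra_simps)
  also have "\<dots> \<le> \<bar>f x\<bar> * \<bar>g x - g y\<bar> + \<bar>g y\<bar> * \<bar>f x - f y\<bar>"
    by (metis abs_mult abs_triangle_ineq)
  also have "\<dots> \<le> A * (M * \<bar>x - y\<bar>) + B * (L * \<bar>x - y\<bar>)"
    using lipschitz_on_normD[OF f xy] lipschitz_on_normD[OF g xy] xy assms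
    by (intro add_mono mult_mono) auto
  finally show "dist (f x * g x) (f y * g y) \<le> (A * M + B * L) * dist x y"
    by (simp add: dist_real_def algebra_simps)
qed

section \<open>The Kummer density and its weighted version\<close>

text \<open>
  This is an integrating factor of the Stein equation: its logarithmic derivative is
  \<open>drift\<close> divided by \<open>stein_s\<close>.
\<close>

definition weighted_density :: "real \<Rightarrow> real \<Rightarrow> real \<Rightarrow> real \<Rightarrow> real" where
  "weighted_density a b c x = stein_s x * kummer_density a b c x"

text \<open>
  The coefficient of the unknown function in the Stein equation. As a polynomial it is
  $a + (1-b-c)x - cx^2$, with positive root \<open>stein_alpha\<close>.
\<close>

definition drift :: "real \<Rightarrow> real \<Rightarrow> real \<Rightarrow> real \<Rightarrow> real" where
  "drift a b c x = (1 - b) * x - c * x * (1 + x) + a"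

lemma kummer_density_measurable [measurable]: "kummer_density a b c \<in> borel_measurable borel"
  unfolding kummer_density_def by measurable

lemma tricomi_nonneg: "0 < a \<Longrightarrow> 0 \<le> tricomi a b z"
  unfolding tricomi_def set_lebesgue_integral_def
  using Gamma_real_pos[of a] by (intro mult_nonneg_nonneg integral_nonneg_AE) (auto simp: indicator_def)

lemma kummer_density_nonneg:
  assumes "0 < a"
  shows "0 \<le> kummer_density a b c x"
  using tricomi_nonneg[OF assms, of "1 - b" c] Gamma_real_pos[OF assms]
  by (simp add: kummer_density_def)

text \<open>
  The density vanishes on the negative half-line, so integrals over the whole line may replace those
  over the half-line. Working on the whole line, every antiderivative below is an integral
  over some \<open>{..x}\<close>.
\<close>

lemma nn_integral_kummer_density:
  assumes "0 < a" "0 < c"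
  shows "(\<integral>\<^sup>+x. ennreal (kummer_density a b c x) \<partial>lborel) = 1"
proof -
  let ?k = "\<lambda>x. ennreal (kummer_density a b c x)" and ?R = "restrict_space lborel {0::real<..}"
  interpret prob_space "density ?R ?k" by (rule kummer_density_prob_space[OF assms])
  have k: "?k \<in> borel_measurable ?R" by (intro measurable_restrict_space1) measurable
  have "1 = emeasure (density ?R ?k) (space ?R)" using emeasure_space_1 by simp
  also have "\<dots> = (\<integral>\<^sup>+x. ?k x * indicator (space ?R) x \<partial>?R)"
    by (intro emeasure_density k) (simp add: sets_restrict_space_iff)
  also have "\<dots> = (\<integral>\<^sup>+x. ?k x \<partial>?R)" by (intro nn_integral_cong) simp
  also have "\<dots> = (\<integral>\<^sup>+x. ?k x \<partial>lborel)"
    by (subst nn_integral_restrict_space) (auto intro!: nn_integral_cong simp: indicator_def kummer_density_def)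
  finally show ?thesis ..
qed

lemma has_bochner_integral_kummer_density:
  assumes "0 < a" "0 < c"
  shows "has_bochner_integral lborel (kummer_density a b c) 1"
  using nn_integral_kummer_density[OF assms] kummer_density_nonneg[OF assms(1)]
  by (intro has_bochner_integral_nn_integral) auto

lemma integrable_kummer_density:
  assumes "0 < a" "0 < c"
  shows "integrable lborel (kummer_density a b c)"
  using has_bochner_integral_kummer_density[OF assms] by (simp add: has_bochner_integral_iff)

text \<open>
  The normalizing constant only matters through its sign. It is nonzero because the density has
  total mass 1.
\<close>

lemma kummer_density_eq:
  assumes "0 < a" "0 < c"
  obtains C where "0 < C" and
    "\<And>x. 0 < x \<Longrightarrow> kummer_density a b c x = C * (x powr (a - 1) * (1 + x) powr (- a - b) * exp (- c * x))"
proof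
  let ?C = "1 / (Gamma a * tricomi a (1 - b) c)"
  show "kummer_density a b c x = ?C * (x powr (a - 1) * (1 + x) powr (- a - b) * exp (- c * x))" if "0 < x" for x
    using that by (simp add: kummer_density_def)
  have "?C \<noteq> 0"
  proof
    assume "?C = 0"
    hence "kummer_density a b c = (\<lambda>_. 0)" by (auto simp: kummer_density_def)
    thus False using nn_integral_kummer_density[OF assms, of b] by simp
  qed
  thus "0 < ?C"
    using tricomi_nonneg[OF assms(1), of "1 - b" c] Gamma_real_pos[OF assms(1)] by (simp add: less_le)
qed

lemma kummer_density_pos:
  assumes "0 < a" "0 < c" "0 < x"
  shows "0 < kummer_density a b c x"
  using kummer_density_eq[OF assms(1,2), of b] assms(3) by (metis add_pos_pos exp_gt_zero mult_pos_pos powr_gt_zero zero_less_one less_irrefl)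

lemma isCont_kummer_density:
  assumes "0 < a" "0 < c" "0 < x"
  shows "isCont (kummer_density a b c) x"
proof -
  obtain C where C: "\<And>x. 0 < x \<Longrightarrow> kummer_density a b c x = C * (x powr (a - 1) * (1 + x) powr (- a - b) * exp (- c * x))"
    using kummer_density_eq[OF assms(1,2)] by metis
  have "continuous_on {0<..} (\<lambda>x. C * (x powr (a - 1) * (1 + x) powr (- a - b) * exp (- c * x)))"
    by (intro continuous_intros) auto
  hence "continuous_on {0<..} (kummer_density a b c)"
    by (rule continuous_on_eq) (simp add: C)
  thus ?thesis using assms(3) by (simp add: continuous_on_eq_continuous_at)
qed

lemma weighted_density_eq:
  assumes "0 < a" "0 < c"
  obtains C where "0 < C" and
    "\<And>x. 0 < x \<Longrightarrow> weighted_density a b c x = C * (x powr a * (1 + x) powr (1 - a - b) * exp (- c * x))"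
proof -
  obtain C where C: "0 < C"
    "\<And>x. 0 < x \<Longrightarrow> kummer_density a b c x = C * (x powr (a - 1) * (1 + x) powr (- a - b) * exp (- c * x))"
    using kummer_density_eq[OF assms] by metis
  have "weighted_density a b c x = C * (x powr a * (1 + x) powr (1 - a - b) * exp (- c * x))" if "0 < x" for x
  proof -
    have "x powr a = x * x powr (a - 1)" "(1 + x) powr (1 - a - b) = (1 + x) * (1 + x) powr (- a - b)"
      using that powr_add[of x 1 "a - 1"] powr_add[of "1 + x" 1 "- a - b"] by (simp_all add: algebra_simps)
    thus ?thesis using C(2)[OF that] by (simp add: weighted_density_def stein_s_def)
  qed
  with C(1) show ?thesis by (rule that)
qed

lemma weighted_density_pos:
  assumes "0 < a" "0 < c" "0 < x"
  shows "0 < weighted_density a b c x"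
  using kummer_density_pos[OF assms] assms(3) by (simp add: weighted_density_def stein_s_def)

lemma DERIV_weighted_density:
  assumes "0 < a" "0 < c" "0 < x"
  shows "(weighted_density a b c has_real_derivative kummer_density a b c x * drift a b c x) (at x)"
proof -
  obtain C where C: "\<And>x. 0 < x \<Longrightarrow>
      weighted_density a b c x = C * (x powr a * (1 + x) powr (1 - a - b) * exp (- c * x))"
    using weighted_density_eq[OF assms(1,2)] by metis
  have s: "x powr (a - 1) = x powr a / x" "(1 + x) powr (- a - b) = (1 + x) powr (1 - a - b) / (1 + x)"
    using assms(3) powr_diff[of x a 1] powr_diff[of "1 + x" "1 - a - b" 1] by (simp_all add: algebra_simps)
  have "((\<lambda>x. C * (x powr a * (1 + x) powr (1 - a - b) * exp (- c * x))) has_real_derivative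
      C * (x powr a * (1 + x) powr (1 - a - b) * exp (- c * x)) * (a / x + (1 - a - b) / (1 + x) - c)) (at x)"
    using assms(3) by (auto intro!: derivative_eq_intros simp: s) (simp add: field_simps s)
  hence "(weighted_density a b c has_real_derivative
      C * (x powr a * (1 + x) powr (1 - a - b) * exp (- c * x)) * (a / x + (1 - a - b) / (1 + x) - c)) (at x)"
    by (rule has_field_derivative_transform_within_open[where S = "{0<..}"]) (use assms(3) C in auto)
  also have "C * (x powr a * (1 + x) powr (1 - a - b) * exp (- c * x)) * (a / x + (1 - a - b) / (1 + x) - c)
      = stein_s x * kummer_density a b c x * (a / x + (1 - a - b) / (1 + x) - c)"
    using C[OF assms(3)] by (simp add: weighted_density_def)
  also have "\<dots> = kummer_density a b c x * (x * (1 + x) * (a / x + (1 - a - b) / (1 + x) - c))"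
    by (simp only: stein_s_def mult_ac)
  also have "x * (1 + x) * (a / x + (1 - a - b) / (1 + x) - c) = drift a b c x"
  proof -
    have "x * y * (a / x + d / y - c) = a * y + d * x - c * x * y" if "y \<noteq> 0" for y d
      using that assms(3) by (simp add: field_simps)
    from this[of "1 + x" "1 - a - b"]
    have "x * (1 + x) * (a / x + (1 - a - b) / (1 + x) - c) = a * (1 + x) + (1 - a - b) * x - c * x * (1 + x)"
      using assms(3) by linarith
    thus ?thesis by (simp add: drift_def algebra_simps)
  qed
  finally show ?thesis .
qed

lemma weighted_density_at_0:
  assumes "0 < a" "0 < c"
  shows "(weighted_density a b c \<longlongrightarrow> 0) (at_right 0)"
proof -
  obtain C where C: "\<And>x. 0 < x \<Longrightarrow>
      weighted_density a b c x = C * (x powr a * (1 + x) powr (1 - a - b) * exp (- c * x))"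
    using weighted_density_eq[OF assms] by metis
  have "((\<lambda>x. C * (x powr a * (1 + x) powr (1 - a - b) * exp (- c * x))) \<longlongrightarrow> 0) (at_right 0)"
    using assms by real_asymp
  thus ?thesis
    by (rule Lim_transform_eventually) (auto simp: C eventually_at_right_field intro!: exI[of _ 1])
qed

lemma weighted_density_at_top:
  assumes "0 < a" "0 < c"
  shows "(weighted_density a b c \<longlongrightarrow> 0) at_top"
proof -
  obtain C where C: "\<And>x. 0 < x \<Longrightarrow>
      weighted_density a b c x = C * (x powr a * (1 + x) powr (1 - a - b) * exp (- c * x))"
    using weighted_density_eq[OF assms] by metis
  have "((\<lambda>x. C * (x powr a * (1 + x) powr (1 - a - b) * exp (- c * x))) \<longlongrightarrow> 0) at_top"
    using assms by real_asymp
  thus ?thesis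
    by (rule Lim_transform_eventually) (auto simp: C intro: eventually_mono[OF eventually_gt_at_top[of 0]])
qed

section \<open>The Kummer distribution function\<close>

definition kummer_cdf :: "real \<Rightarrow> real \<Rightarrow> real \<Rightarrow> real \<Rightarrow> real" where
  "kummer_cdf a b c x = (LBINT t:{..x}. kummer_density a b c t)"

lemma DERIV_kummer_cdf:
  assumes "0 < a" "0 < c" "0 < x"
  shows "(kummer_cdf a b c has_real_derivative kummer_density a b c x) (at x)"
  using DERIV_set_integral_atMost_if_isCont[OF integrable_kummer_density isCont_kummer_density] assms
  unfolding kummer_cdf_def by blast

lemma set_integral_atMost_0_kummer_density [simp]:
  "(LBINT t:{..0}. kummer_density a b c t * g t) = 0"
  unfolding set_lebesgue_integral_def
  by (rule integral_eq_zero_AE) (auto simp: kummer_density_def indicator_def)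

lemma tendsto_0_set_integral_kummer_density:
  assumes "integrable lborel (\<lambda>t. kummer_density a b c t * g t)"
  shows "((\<lambda>x. LBINT t:{..x}. kummer_density a b c t * g t) \<longlongrightarrow> 0) (at_right 0)"
  using isCont_set_integral_atMost[OF assms, of 0] by (simp add: isCont_def filterlim_at_split)

lemma kummer_cdf_at_0:
  assumes "0 < a" "0 < c"
  shows "(kummer_cdf a b c \<longlongrightarrow> 0) (at_right 0)"
  using tendsto_0_set_integral_kummer_density[of a b c "\<lambda>_. 1"] integrable_kummer_density[OF assms]
  by (simp add: kummer_cdf_def[abs_def])

lemma kummer_cdf_at_top:
  assumes "0 < a" "0 < c"
  shows "(kummer_cdf a b c \<longlongrightarrow> 1) at_top"
  using tendsto_integral_at_top[OF _ integrable_kummer_density[OF assms, of b]]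
    has_bochner_integral_kummer_density[OF assms, of b]
  by (simp add: kummer_cdf_def[abs_def] set_lebesgue_integral_def has_bochner_integral_iff)

lemma kummer_tail_eq:
  assumes "0 < a" "0 < c"
  shows "(LBINT t:{x<..}. kummer_density a b c t) = 1 - kummer_cdf a b c x"
proof -
  have "integral\<^sup>L lborel (kummer_density a b c) = 1"
    by (rule has_bochner_integral_integral_eq[OF has_bochner_integral_kummer_density[OF assms]])
  thus ?thesis
    using set_integral_greaterThan_eq[OF integrable_kummer_density[OF assms, of b], of x]
    by (simp only: kummer_cdf_def)
qed

section \<open>Monotone ratios\<close>

text \<open>
  The drift has slope $1-b-c-2cx$, which is at most $1-b-c$ for $x \ge 0$.
\<close>

lemma drift_antimono:
  assumes "0 < c" "1 - b - c \<le> 0" "0 < x" "x \<le> y"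
  shows "drift a b c y \<le> drift a b c x"
proof -
  have "drift a b c x - drift a b c y = (y - x) * (c * (x + y) - (1 - b - c))"
    by (simp add: drift_def algebra_simps)
  moreover have "0 \<le> (y - x) * (c * (x + y) - (1 - b - c))"
  proof (rule mult_nonneg_nonneg)
    have "0 < c * (x + y)" using assms by simp
    thus "0 \<le> c * (x + y) - (1 - b - c)" using assms(2) by linarith
  qed (use assms in simp)
  ultimately show ?thesis by simp
qed

text \<open>
  Freeze the drift at \<open>y\<close>: since $p' = kT$ and $K' = k$ for the weighted density $p$, the
  density $k$, its distribution function $K$ and the drift $T$, the function $p - T(y)K$ has
  derivative $k\,(T - T(y))$. This is nonnegative on $(0,y]$, and the function starts from the
  value 0.
\<close>

lemma drift_mult_kummer_cdf_le:
  assumes "0 < a" "0 < c" "1 - b - c \<le> 0" "0 < y"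
  shows "drift a b c y * kummer_cdf a b c y \<le> weighted_density a b c y"
proof -
  define \<rho> where "\<rho> = (\<lambda>x. weighted_density a b c x - drift a b c y * kummer_cdf a b c x)"
  have mono: "\<rho> x \<le> \<rho> y" if "0 < x" "x \<le> y" for x
  proof (rule DERIV_nonneg_imp_nondecreasing[OF \<open>x \<le> y\<close>])
    fix z assume z: "x \<le> z" "z \<le> y"
    have "(\<rho> has_real_derivative kummer_density a b c z * (drift a b c z - drift a b c y)) (at z)"
      unfolding \<rho>_def using assms z \<open>0 < x\<close>
      by (auto intro!: derivative_eq_intros DERIV_weighted_density DERIV_kummer_cdf simp: algebra_simps)
    moreover have "0 \<le> kummer_density a b c z * (drift a b c z - drift a b c y)"
      using drift_antimono[OF assms(2,3), of z y] z \<open>0 < x\<close>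
      by (intro mult_nonneg_nonneg kummer_density_nonneg assms(1)) auto
    ultimately show "\<exists>d. DERIV \<rho> z :> d \<and> 0 \<le> d" by blast
  qed
  have "(\<rho> \<longlongrightarrow> 0 - drift a b c y * 0) (at_right 0)"
    unfolding \<rho>_def by (intro tendsto_intros weighted_density_at_0 kummer_cdf_at_0 assms)
  moreover have "\<forall>\<^sub>F x in at_right 0. \<rho> x \<le> \<rho> y"
    unfolding eventually_at_right_field using mono \<open>0 < y\<close> by (intro exI[of _ y]) auto
  ultimately have "0 - drift a b c y * 0 \<le> \<rho> y" by (rule tendsto_upperbound) simp
  thus ?thesis by (simp add: \<rho>_def)
qed

text \<open>
  The mirror image of \<open>drift_mult_kummer_cdf_le\<close>, with the boundary value 0 taken at
  infinity.
\<close>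

lemma minus_drift_mult_kummer_tail_le:
  assumes "0 < a" "0 < c" "1 - b - c \<le> 0" "0 < y"
  shows "- drift a b c y * (1 - kummer_cdf a b c y) \<le> weighted_density a b c y"
proof -
  define \<rho> where "\<rho> = (\<lambda>x. weighted_density a b c x + drift a b c y * (1 - kummer_cdf a b c x))"
  have anti: "\<rho> x \<le> \<rho> y" if "y \<le> x" for x
  proof (rule DERIV_nonpos_imp_nonincreasing[OF \<open>y \<le> x\<close>])
    fix z assume z: "y \<le> z" "z \<le> x"
    have "(\<rho> has_real_derivative kummer_density a b c z * (drift a b c z - drift a b c y)) (at z)"
      unfolding \<rho>_def using assms z
      by (auto intro!: derivative_eq_intros DERIV_weighted_density DERIV_kummer_cdf simp: algebra_simps)
    moreover have "kummer_density a b c z * (drift a b c z - drift a b c y) \<le> 0"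
      using drift_antimono[OF assms(2,3,4) z(1)]
      by (intro mult_nonneg_nonpos kummer_density_nonneg assms(1)) auto
    ultimately show "\<exists>d. DERIV \<rho> z :> d \<and> d \<le> 0" by blast
  qed
  have "(\<rho> \<longlongrightarrow> 0 + drift a b c y * (1 - 1)) at_top"
    unfolding \<rho>_def by (intro tendsto_intros weighted_density_at_top kummer_cdf_at_top assms)
  moreover have "\<forall>\<^sub>F x in at_top. \<rho> x \<le> \<rho> y"
    using anti by (auto intro: eventually_mono[OF eventually_ge_at_top[of y]])
  ultimately have "0 + drift a b c y * (1 - 1) \<le> \<rho> y" by (rule tendsto_upperbound) simp
  thus ?thesis by (simp add: \<rho>_def)
qed

text \<open>
  The derivative of $K/p$ is $k\,(p - TK)/p^2$, so its sign is that of the inequality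
  \<open>drift_mult_kummer_cdf_le\<close>.
\<close>

lemma kummer_cdf_ratio_mono:
  assumes "0 < a" "0 < c" "1 - b - c \<le> 0" "0 < x" "x \<le> y"
  shows "kummer_cdf a b c x / weighted_density a b c x \<le> kummer_cdf a b c y / weighted_density a b c y"
proof (rule DERIV_nonneg_imp_nondecreasing[OF \<open>x \<le> y\<close>])
  fix z assume "x \<le> z"
  hence z: "0 < z" using assms by simp
  let ?k = "kummer_density a b c z" and ?K = "kummer_cdf a b c z" and ?p = "weighted_density a b c z"
  have "((\<lambda>x. kummer_cdf a b c x / weighted_density a b c x) has_real_derivative
      ?k * (?p - drift a b c z * ?K) / ?p\<^sup>2) (at z)"
    using assms z weighted_density_pos[OF assms(1,2) z, of b]
    by (auto intro!: derivative_eq_intros DERIV_weighted_density DERIV_kummer_cdf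
        simp: field_simps power2_eq_square)
  moreover have "0 \<le> ?k * (?p - drift a b c z * ?K) / ?p\<^sup>2"
    using drift_mult_kummer_cdf_le[OF assms(1-3) z] kummer_density_nonneg[OF assms(1)] by simp
  ultimately show "\<exists>d. ((\<lambda>x. kummer_cdf a b c x / weighted_density a b c x) has_real_derivative d) (at z) \<and> 0 \<le> d"
    by blast
qed

lemma kummer_tail_ratio_antimono:
  assumes "0 < a" "0 < c" "1 - b - c \<le> 0" "0 < x" "x \<le> y"
  shows "(1 - kummer_cdf a b c y) / weighted_density a b c y \<le> (1 - kummer_cdf a b c x) / weighted_density a b c x"
proof (rule DERIV_nonpos_imp_nonincreasing[OF \<open>x \<le> y\<close>])
  fix z assume "x \<le> z"
  hence z: "0 < z" using assms by simp
  let ?k = "kummer_density a b c z" and ?K = "1 - kummer_cdf a b c z" and ?p = "weighted_density a b c z"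
  have "((\<lambda>x. (1 - kummer_cdf a b c x) / weighted_density a b c x) has_real_derivative
      - (?k * (?p - - drift a b c z * ?K) / ?p\<^sup>2)) (at z)"
    using assms z weighted_density_pos[OF assms(1,2) z, of b]
    by (auto intro!: derivative_eq_intros DERIV_weighted_density DERIV_kummer_cdf
        simp: field_simps power2_eq_square)
  moreover have "- (?k * (?p - - drift a b c z * ?K) / ?p\<^sup>2) \<le> 0"
    using minus_drift_mult_kummer_tail_le[OF assms(1-3) z] kummer_density_nonneg[OF assms(1)] by simp
  ultimately show "\<exists>d. ((\<lambda>x. (1 - kummer_cdf a b c x) / weighted_density a b c x) has_real_derivative d) (at z) \<and> d \<le> 0"
    by blast
qed

section \<open>The Stein equation and its integrating factor\<close>

text \<open>
  The two integrals differ by a half-line on which the density vanishes and by a point.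
\<close>

lemma set_integral_kummer_density_Ioo:
  fixes g :: "real \<Rightarrow> real"
  assumes "integrable lborel (\<lambda>t. kummer_density a b c t * g t)"
  shows "(LBINT t:{0<..<x}. kummer_density a b c t * g t) = (LBINT t:{..x}. kummer_density a b c t * g t)"
  unfolding set_lebesgue_integral_def
proof (rule integral_cong_AE)
  have [measurable]: "(\<lambda>t. kummer_density a b c t * g t) \<in> borel_measurable borel"
    using borel_measurable_integrable[OF assms] by simp
  show "(\<lambda>t. indicator {0<..<x} t *\<^sub>R (kummer_density a b c t * g t)) \<in> borel_measurable lborel"
    "(\<lambda>t. indicator {..x} t *\<^sub>R (kummer_density a b c t * g t)) \<in> borel_measurable lborel"
    by measurable
  show "AE t in lborel. indicator {0<..<x} t *\<^sub>R (kummer_density a b c t * g t)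
      = indicator {..x} t *\<^sub>R (kummer_density a b c t * g t)"
    using AE_lborel_singleton[of x] by eventually_elim (auto simp: indicator_def kummer_density_def)
qed

lemma stein_sol_eq:
  assumes "integrable lborel (\<lambda>t. kummer_density a b c t * g t)"
  shows "stein_sol a b c g = (\<lambda>x. (LBINT t:{..x}. kummer_density a b c t * g t) / weighted_density a b c x)"
  by (simp add: fun_eq_iff stein_sol_def set_integral_kummer_density_Ioo[OF assms] weighted_density_def)

text \<open>
  With the integrating factor $p$, the Stein equation for $f$ reads $(pf)' = kg$. This lemma and
  \<open>DERIV_weighted_density_mult_solution\<close> are the two directions of that equivalence.
\<close>

lemma stein_eq_at_quotient:
  assumes "0 < a" "0 < c" "0 < x"
    and F: "(F has_real_derivative kummer_density a b c x * g x) (at x)"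
  shows "stein_eq_at a b c g (\<lambda>x. F x / weighted_density a b c x) x"
proof -
  let ?p = "weighted_density a b c x" and ?k = "kummer_density a b c x"
  have p: "?p = x * (1 + x) * ?k" "0 < ?p" "0 < ?k"
    using assms by (simp_all add: weighted_density_def stein_s_def kummer_density_pos)
  define D where "D = (?k * g x * ?p - F x * (?k * drift a b c x)) / ?p\<^sup>2"
  have "((\<lambda>x. F x / weighted_density a b c x) has_real_derivative D) (at x)"
    unfolding D_def using p
    by (auto intro!: derivative_eq_intros F DERIV_weighted_density assms(1-3) simp: power2_eq_square)
  moreover have "x * (x + 1) * D + drift a b c x * (F x / ?p) = g x"
  proof -
    have "D = ?k / ?p * (g x - F x * drift a b c x / ?p)"
      using p(2) by (simp add: D_def field_simps power2_eq_square)
    moreover have "x * (x + 1) * (?k / ?p) = 1" using p assms(3) by (simp add: mult_ac add.commute)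
    ultimately have "x * (x + 1) * D = g x - F x * drift a b c x / ?p"
      by (simp only: mult.assoc[symmetric] mult_1)
    thus ?thesis by simp
  qed
  ultimately show ?thesis unfolding stein_eq_at_def drift_def by blast
qed

lemma DERIV_weighted_density_mult_solution:
  assumes "0 < a" "0 < c" "0 < x" and "stein_eq_at a b c g f x"
  shows "((\<lambda>x. weighted_density a b c x * f x) has_real_derivative kummer_density a b c x * g x) (at x)"
proof -
  obtain D where D: "(f has_real_derivative D) (at x)" "x * (x + 1) * D + drift a b c x * f x = g x"
    using assms(4) unfolding stein_eq_at_def drift_def by blast
  have "((\<lambda>x. weighted_density a b c x * f x) has_real_derivative
      kummer_density a b c x * (x * (x + 1) * D + drift a b c x * f x)) (at x)"
    by (rule DERIV_cong[OF DERIV_mult[OF DERIV_weighted_density[OF assms(1-3)] D(1)]])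
       (simp add: weighted_density_def stein_s_def algebra_simps)
  thus ?thesis by (simp add: D(2))
qed

text \<open>
  If $f$ and $f_h$ both solve the equation, then $p\,(f - f_h)$ is constant. The constant is 0,
  because $pf$ and $pf_h$ both tend to 0 at 0 (the former since $f$ is bounded and $p$ vanishes at 0).
\<close>

lemma bounded_solution_unique:
  assumes "0 < a" "0 < c" and u: "integrable lborel (\<lambda>t. kummer_density a b c t * g t)"
    and sol: "classical_solution a b c g (stein_sol a b c g)"
    and f: "classical_solution a b c g f" "bounded (f ` {0<..})" and "0 < x"
  shows "f x = stein_sol a b c g x"
proof -
  let ?p = "weighted_density a b c" and ?F = "\<lambda>x. LBINT t:{..x}. kummer_density a b c t * g t"
  have p: "?p x \<noteq> 0" if "0 < x" for x using weighted_density_pos[OF assms(1,2) that, of b] by simp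
  have F: "?p x * stein_sol a b c g x = ?F x" if "0 < x" for x
    using p[OF that] by (simp add: stein_sol_eq[OF u])
  have "\<exists>e. \<forall>x\<in>{0<..}. ?p x * f x - ?p x * stein_sol a b c g x = e"
  proof (rule has_field_derivative_zero_constant)
    fix x :: real assume "x \<in> {0<..}"
    hence x: "0 < x" by simp
    have "((\<lambda>x. ?p x * f x - ?p x * stein_sol a b c g x) has_real_derivative 0) (at x)"
      using DERIV_diff[OF DERIV_weighted_density_mult_solution[OF assms(1,2) x, of b g f]
          DERIV_weighted_density_mult_solution[OF assms(1,2) x, of b g "stein_sol a b c g"]]
        x sol f(1) by (simp add: classical_solution_def)
    thus "((\<lambda>x. ?p x * f x - ?p x * stein_sol a b c g x) has_real_derivative 0) (at x within {0<..})"
      by (rule has_field_derivative_at_within)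
  qed (rule convex_real_interval)
  then obtain e where e: "\<And>x. 0 < x \<Longrightarrow> ?p x * f x - ?F x = e" using F by auto
  obtain B where B: "\<And>x. 0 < x \<Longrightarrow> \<bar>f x\<bar> \<le> B"
    using f(2) unfolding bounded_iff by auto
  have "((\<lambda>x. ?p x * f x) \<longlongrightarrow> 0) (at_right 0)"
  proof (rule Lim_null_comparison)
    show "\<forall>\<^sub>F x in at_right 0. norm (?p x * f x) \<le> ?p x * B"
      unfolding eventually_at_right_field
      using B weighted_density_pos[OF assms(1,2), THEN less_imp_le]
      by (auto simp: abs_mult intro!: exI[of _ 1] mult_left_mono)
    show "((\<lambda>x. ?p x * B) \<longlongrightarrow> 0) (at_right 0)"
      using weighted_density_at_0[OF assms(1,2)] by (rule tendsto_mult_left_zero)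
  qed
  from tendsto_diff[OF this tendsto_0_set_integral_kummer_density[OF u]]
  have "((\<lambda>x. ?p x * f x - ?F x) \<longlongrightarrow> 0) (at_right 0)" by simp
  moreover have "\<forall>\<^sub>F x in at_right 0. ?p x * f x - ?F x = e"
    unfolding eventually_at_right_field using e by (intro exI[of _ 1]) auto
  ultimately have "((\<lambda>x. e) \<longlongrightarrow> 0) (at_right (0::real))"
    by (rule Lim_transform_eventually)
  hence "e = 0" by (simp add: tendsto_const_iff)
  with e[OF \<open>0 < x\<close>] F[OF \<open>0 < x\<close>] have "?p x * f x = ?p x * stein_sol a b c g x" by linarith
  thus ?thesis using p[OF \<open>0 < x\<close>] by simp
qed

section \<open>Bounds for the solution\<close>

lemma integrable_kummer_density_mult:
  fixes g :: "real \<Rightarrow> real"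
  assumes "0 < a" "0 < c" and g: "g \<in> borel_measurable (restrict_space borel {0<..})"
    and G: "\<And>t. 0 < t \<Longrightarrow> \<bar>g t\<bar> \<le> G"
  shows "integrable lborel (\<lambda>t. kummer_density a b c t * g t)"
proof (rule Bochner_Integration.integrable_bound)
  show "integrable lborel (\<lambda>t. G * kummer_density a b c t)"
    by (intro integrable_mult_right integrable_kummer_density assms)
  have [measurable]: "(\<lambda>t. indicator {0<..} t *\<^sub>R g t) \<in> borel_measurable borel"
    using g by (subst (asm) borel_measurable_restrict_space_iff) auto
  have "(\<lambda>t. kummer_density a b c t * g t) = (\<lambda>t. kummer_density a b c t * (indicator {0<..} t *\<^sub>R g t))"
    by (auto simp: fun_eq_iff kummer_density_def)
  also have "\<dots> \<in> borel_measurable lborel" by measurable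
  finally show "(\<lambda>t. kummer_density a b c t * g t) \<in> borel_measurable lborel" .
  show "AE t in lborel. norm (kummer_density a b c t * g t) \<le> norm (G * kummer_density a b c t)"
  proof (rule AE_I2)
    fix t
    show "norm (kummer_density a b c t * g t) \<le> norm (G * kummer_density a b c t)"
    proof (cases "0 < t")
      case True
      hence "\<bar>g t\<bar> \<le> \<bar>G\<bar>" using G[of t] by simp
      thus ?thesis by (simp add: abs_mult mult.commute mult_right_mono)
    qed (simp add: kummer_density_def)
  qed
qed

text \<open>
  A bound on the half-line suffices, because the density vanishes elsewhere.
\<close>

lemma abs_LBINT_kummer_density_le:
  fixes g :: "real \<Rightarrow> real"
  assumes "0 < a" "0 < c" and u: "integrable lborel (\<lambda>t. kummer_density a b c t * g t)"
    and G: "\<And>t. 0 < t \<Longrightarrow> \<bar>g t\<bar> \<le> G" and [measurable]: "A \<in> sets borel"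
  shows "\<bar>LBINT t:A. kummer_density a b c t * g t\<bar> \<le> G * (LBINT t:A. kummer_density a b c t)"
proof -
  have i: "set_integrable lborel A w" if "integrable lborel w" for w :: "real \<Rightarrow> real"
    using that unfolding set_integrable_def by (intro integrable_mult_indicator) auto
  have "\<bar>LBINT t:A. kummer_density a b c t * g t\<bar> \<le> (LBINT t:A. \<bar>kummer_density a b c t * g t\<bar>)"
    using set_integral_norm_bound[OF i[OF u]] by simp
  also have "\<dots> \<le> (LBINT t:A. G * kummer_density a b c t)"
  proof (rule set_integral_mono)
    fix t
    show "\<bar>kummer_density a b c t * g t\<bar> \<le> G * kummer_density a b c t"
    proof (cases "0 < t")
      case True
      thus ?thesis using G[of t] kummer_density_nonneg[OF assms(1)]
        by (simp add: abs_mult mult.commute mult_right_mono)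
    qed (simp add: kummer_density_def)
  qed (use u in \<open>auto intro!: i integrable_kummer_density assms(1,2)\<close>)
  finally show ?thesis by simp
qed

lemma stein_M_eq_max_ratio:
  assumes "0 < a" "0 < c"
  shows "stein_M a b c = (let \<alpha> = stein_alpha a b c in
    max (kummer_cdf a b c \<alpha> / weighted_density a b c \<alpha>) ((1 - kummer_cdf a b c \<alpha>) / weighted_density a b c \<alpha>))"
proof -
  have "(LBINT t:{0<..<x}. kummer_density a b c t) = kummer_cdf a b c x" for x
    using set_integral_kummer_density_Ioo[of a b c "\<lambda>_. 1" x] integrable_kummer_density[OF assms, of b]
    by (simp add: kummer_cdf_def)
  thus ?thesis
    unfolding stein_M_def Let_def kummer_tail_eq[OF assms] weighted_density_def by simp
qed

lemma stein_alpha_pos: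
  assumes "0 < a" "0 < c"
  shows "0 < stein_alpha a b c"
proof -
  have "\<bar>1 - b - c\<bar> < sqrt ((1 - b - c)\<^sup>2 + 4 * a * c)"
    using assms by (intro real_less_rsqrt) simp
  thus ?thesis using assms by (simp add: stein_alpha_def)
qed

text \<open>
  To the left of \<open>stein_alpha\<close> the integral over $(0,x)$ is estimated, to the right of it
  the integral over $(x,\infty)$, which is the same up to sign since \<open>g\<close> is centred. In both
  cases the monotone ratio is largest at \<open>stein_alpha\<close> itself.
\<close>

lemma abs_stein_sol_le:
  fixes g :: "real \<Rightarrow> real"
  assumes "0 < a" "0 < c" "1 - b - c \<le> 0"
    and u: "integrable lborel (\<lambda>t. kummer_density a b c t * g t)"
    and centred: "(LBINT t. kummer_density a b c t * g t) = 0"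
    and G: "\<And>t. 0 < t \<Longrightarrow> \<bar>g t\<bar> \<le> G" and "0 < x"
  shows "\<bar>stein_sol a b c g x\<bar> \<le> stein_M a b c * G"
proof -
  let ?p = "weighted_density a b c" and ?K = "kummer_cdf a b c" and ?\<alpha> = "stein_alpha a b c"
  let ?F = "LBINT t:{..x}. kummer_density a b c t * g t"
  have G0: "0 \<le> G" using G[of 1] by simp
  have p: "0 < ?p x" using weighted_density_pos[OF assms(1,2) \<open>0 < x\<close>] .
  have left: "\<bar>?F\<bar> \<le> G * ?K x"
    using abs_LBINT_kummer_density_le[OF assms(1,2) u G, where A = "{..x}"] by (simp add: kummer_cdf_def)
  have right: "\<bar>?F\<bar> \<le> G * (1 - ?K x)"
    using abs_LBINT_kummer_density_le[OF assms(1,2) u G, where A = "{x<..}"]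
    by (simp add: set_integral_greaterThan_eq[OF u] centred kummer_tail_eq[OF assms(1,2)])
  have "\<exists>m\<le>stein_M a b c. \<bar>?F\<bar> / ?p x \<le> G * m"
  proof (cases "x \<le> ?\<alpha>")
    case True
    have "\<bar>?F\<bar> / ?p x \<le> G * (?K x / ?p x)"
      using divide_right_mono[OF left] p by simp
    moreover have "?K x / ?p x \<le> stein_M a b c"
      using kummer_cdf_ratio_mono[OF assms(1-3) \<open>0 < x\<close> True] by (simp add: stein_M_eq_max_ratio[OF assms(1,2)] Let_def)
    ultimately show ?thesis by blast
  next
    case False
    have "\<bar>?F\<bar> / ?p x \<le> G * ((1 - ?K x) / ?p x)"
      using divide_right_mono[OF right] p by simp
    moreover have "(1 - ?K x) / ?p x \<le> stein_M a b c"
      using kummer_tail_ratio_antimono[OF assms(1-3) stein_alpha_pos[OF assms(1,2), of b], of x] False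
      by (simp add: stein_M_eq_max_ratio[OF assms(1,2)] Let_def)
    ultimately show ?thesis by blast
  qed
  then obtain m where "m \<le> stein_M a b c" "\<bar>?F\<bar> / ?p x \<le> G * m" by blast
  thus ?thesis
    using mult_left_mono[OF \<open>m \<le> _\<close> G0] p by (simp add: stein_sol_eq[OF u] mult.commute)
qed

lemma lipschitz_inverse_weighted_density:
  assumes "0 < a" "0 < c" "0 < u"
  obtains L where "L-lipschitz_on {u..v} (\<lambda>x. 1 / weighted_density a b c x)"
proof -
  let ?p = "weighted_density a b c"
  let ?d = "\<lambda>x. - (kummer_density a b c x * drift a b c x) / (?p x)\<^sup>2"
  have p: "0 < ?p x" if "0 < x" for x using weighted_density_pos[OF assms(1,2) that] .
  have "continuous_on {u..v} ?p"
    by (rule DERIV_continuous_on[OF has_field_derivative_at_within[OF DERIV_weighted_density]])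
       (use assms in auto)
  moreover have "continuous_on {u..v} (kummer_density a b c)"
    using isCont_kummer_density[OF assms(1,2)] assms(3) by (auto intro!: continuous_at_imp_continuous_on)
  moreover have "?p x \<noteq> 0" if "x \<in> {u..v}" for x using p[of x] that assms by simp
  ultimately have "continuous_on {u..v} ?d"
    unfolding drift_def by (intro continuous_intros) auto
  hence "bounded (?d ` {u..v})" by (intro compact_imp_bounded compact_continuous_image) auto
  then obtain B where "0 < B" and "\<forall>y\<in>?d ` {u..v}. norm y \<le> B"
    unfolding bounded_pos by blast
  hence B: "0 \<le> B" "\<And>x. x \<in> {u..v} \<Longrightarrow> norm (?d x) \<le> B"
    by (simp, blast)
  have "B-lipschitz_on {u..v} (\<lambda>x. 1 / ?p x)"
  proof (rule bounded_derivative_imp_lipschitz[where f' = "\<lambda>x h. ?d x * h"])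
    fix x assume x: "x \<in> {u..v}"
    have "((\<lambda>x. 1 / ?p x) has_real_derivative ?d x) (at x)"
      using assms x p[of x] by (auto intro!: derivative_eq_intros DERIV_weighted_density simp: power2_eq_square)
    thus "((\<lambda>x. 1 / ?p x) has_derivative (\<lambda>h. ?d x * h)) (at x within {u..v})"
      unfolding has_field_derivative_def by (rule has_derivative_at_withinI)
    show "onorm (\<lambda>h. ?d x * h) \<le> B"
    proof (rule onorm_bound[OF B(1)])
      show "norm (?d x * h) \<le> B * norm h" for h
        unfolding norm_mult by (rule mult_right_mono[OF B(2)[OF x] norm_ge_zero])
    qed
  qed (auto simp: B(1))
  thus ?thesis by (rule that)
qed

text \<open>
  On a compact interval inside the half-line the integrand and the derivative of the reciprocal of
  the weighted density are bounded, so the solution is a product of two Lipschitz functions there.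
  The equation itself comes from Lebesgue's differentiation theorem.
\<close>

lemma caratheodory_solution_stein_sol:
  fixes g :: "real \<Rightarrow> real"
  assumes "0 < a" "0 < c"
    and u: "integrable lborel (\<lambda>t. kummer_density a b c t * g t)"
    and G: "\<And>t. 0 < t \<Longrightarrow> \<bar>g t\<bar> \<le> G"
  shows "caratheodory_solution a b c g (stein_sol a b c g)"
  unfolding caratheodory_solution_def
proof (intro conjI allI impI)
  let ?F = "\<lambda>x. LBINT t:{..x}. kummer_density a b c t * g t"
  let ?q = "\<lambda>x. 1 / weighted_density a b c x"
  show "AE x in lborel. 0 < x \<longrightarrow> stein_eq_at a b c g (stein_sol a b c g) x"
    using AE_DERIV_set_integral_atMost[OF u]
    by eventually_elim (auto simp: stein_sol_eq[OF u] intro!: stein_eq_at_quotient assms(1,2))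
  fix r v :: real assume "0 < r"
  have G0: "0 \<le> G" using G[of 1] by simp
  have bdd: "\<exists>B\<ge>0. \<forall>x\<in>{r..v}. \<bar>w x\<bar> \<le> B" if "continuous_on {r..v} w" for w :: "real \<Rightarrow> real"
  proof -
    have "bounded (w ` {r..v})" using that by (intro compact_imp_bounded compact_continuous_image) auto
    thus ?thesis unfolding bounded_pos by (metis imageI less_imp_le real_norm_def)
  qed
  have "continuous_on {r..v} (kummer_density a b c)"
    using isCont_kummer_density[OF assms(1,2)] \<open>0 < r\<close> by (auto intro!: continuous_at_imp_continuous_on)
  then obtain B where B: "0 \<le> B" "\<And>x. x \<in> {r..v} \<Longrightarrow> \<bar>kummer_density a b c x\<bar> \<le> B"
    using bdd by metis
  have F: "(B * G)-lipschitz_on {r..v} ?F"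
    using B G G0 \<open>0 < r\<close>
    by (intro lipschitz_on_set_integral_atMost u) (auto simp: abs_mult intro!: mult_mono)
  obtain L where q: "L-lipschitz_on {r..v} ?q"
    using lipschitz_inverse_weighted_density[OF assms(1,2) \<open>0 < r\<close>] .
  obtain A1 where A1: "0 \<le> A1" "\<And>x. x \<in> {r..v} \<Longrightarrow> \<bar>?F x\<bar> \<le> A1"
    using bdd[OF lipschitz_on_continuous_on[OF F]] by blast
  obtain A2 where A2: "0 \<le> A2" "\<And>x. x \<in> {r..v} \<Longrightarrow> \<bar>?q x\<bar> \<le> A2"
    using bdd[OF lipschitz_on_continuous_on[OF q]] by blast
  have "(A1 * L + A2 * (B * G))-lipschitz_on {r..v} (\<lambda>x. ?F x * ?q x)"
    by (rule lipschitz_on_mult_bounded[OF F q A1(2) A2(2) A1(1) A2(1)])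
  hence "abs_continuous_on {r..v} (\<lambda>x. ?F x * ?q x)" by (rule lipschitz_imp_abs_continuous_on)
  thus "abs_continuous_on {r..v} (stein_sol a b c g)" by (simp add: stein_sol_eq[OF u])
qed

lemma expectation_kummer_distributed:
  fixes h :: "real \<Rightarrow> real"
  assumes "0 < a" and W: "kummer_distributed P W a b c"
    and h: "h \<in> borel_measurable (restrict_space borel {0<..})"
  shows "(LBINT t. kummer_density a b c t * h t) = (\<integral>\<omega>. h (W \<omega>) \<partial>P)"
proof -
  have "sets (restrict_space lborel {0::real<..}) = sets (restrict_space borel {0<..})"
    by (simp add: sets_restrict_space)
  from measurable_cong_sets[OF this refl] h
  have h': "h \<in> borel_measurable (restrict_space lborel {0<..})" by blast
  have "(\<integral>t. kummer_density a b c t * h t \<partial>restrict_space lborel {0<..}) = (\<integral>\<omega>. h (W \<omega>) \<partial>P)"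
    using W unfolding kummer_distributed_def
    by (rule distributed_integral[OF _ h' kummer_density_nonneg[OF assms(1)]])
  hence "(\<integral>\<omega>. h (W \<omega>) \<partial>P) = (\<integral>t. kummer_density a b c t * h t \<partial>restrict_space lborel {0<..})" ..
  also have "\<dots> = (LBINT t. kummer_density a b c t * h t)"
    by (subst integral_restrict_space)
       (auto intro!: Bochner_Integration.integral_cong simp: indicator_def kummer_density_def)
  finally show ?thesis ..
qed

section \<open>Solution of the Stein equation\<close>

theorem theorem4p2:
  fixes a b c :: real and P :: "'w measure" and W :: "'w \<Rightarrow> real" and h :: "real \<Rightarrow> real"
  assumes "0 < a" and "0 < c"
    and "prob_space P" and "kummer_distributed P W a b c"
    and "h \<in> borel_measurable (restrict_space borel {0<..})" and "bounded (h ` {0<..})"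
  defines "g \<equiv> \<lambda>x. h x - (\<integral>\<omega>. h (W \<omega>) \<partial>P)"
  shows "set_integrable lborel {0<..} (\<lambda>t. kummer_density a b c t * g t)
      \<and> caratheodory_solution a b c g (stein_sol a b c g)
      \<and> (\<forall>x>0. isCont h x \<longrightarrow> stein_eq_at a b c g (stein_sol a b c g) x)
      \<and> (\<forall>x>0. stein_sol a b c g x =
            - 1 / (stein_s x * kummer_density a b c x) *
            (LBINT t:{x<..}. kummer_density a b c t * g t))
      \<and> (continuous_on {0<..} h \<and> 1 - b - c \<le> 0 \<longrightarrow>
            classical_solution a b c g (stein_sol a b c g)
          \<and> bounded (stein_sol a b c g ` {0<..})
          \<and> (\<forall>f. classical_solution a b c g f \<and> bounded (f ` {0<..}) \<longrightarrow>
                (\<forall>x>0. f x = stein_sol a b c g x))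
          \<and> sup_norm (stein_sol a b c g) \<le> stein_M a b c * sup_norm g)"
proof -
  define m where "m = (\<integral>\<omega>. h (W \<omega>) \<partial>P)"
  have g: "g = (\<lambda>x. h x - m)" by (simp add: g_def m_def)
  obtain H where H: "\<And>t. 0 < t \<Longrightarrow> \<bar>h t\<bar> \<le> H"
    using assms(6) unfolding bounded_iff by auto
  have g_bound: "\<bar>g t\<bar> \<le> H + \<bar>m\<bar>" if "0 < t" for t
    using H[OF that] by (simp add: g)
  have h_int: "integrable lborel (\<lambda>t. kummer_density a b c t * h t)"
    using assms(1,2,5) H by (rule integrable_kummer_density_mult)
  have m_int: "integrable lborel (\<lambda>t. kummer_density a b c t * m)"
    by (intro integrable_mult_left integrable_kummer_density assms)
  have u: "integrable lborel (\<lambda>t. kummer_density a b c t * g t)"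
    using Bochner_Integration.integrable_diff[OF h_int m_int] by (simp add: g right_diff_distrib)
  have centred: "(LBINT t. kummer_density a b c t * g t) = 0"
    using Bochner_Integration.integral_diff[OF h_int m_int]
      expectation_kummer_distributed[OF assms(1,4,5)] has_bochner_integral_kummer_density[OF assms(1,2), of b]
    by (simp add: g right_diff_distrib m_def has_bochner_integral_iff)
  have eq_at: "stein_eq_at a b c g (stein_sol a b c g) x" if "0 < x" "isCont h x" for x
  proof -
    have "isCont (\<lambda>t. kummer_density a b c t * g t) x"
      unfolding g by (intro continuous_intros isCont_kummer_density assms that)
    hence "((\<lambda>x. LBINT t:{..x}. kummer_density a b c t * g t) has_real_derivative
        kummer_density a b c x * g x) (at x)"
      by (rule DERIV_set_integral_atMost_if_isCont[OF u])
    thus ?thesis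
      unfolding stein_sol_eq[OF u] by (rule stein_eq_at_quotient[OF assms(1,2) that(1)])
  qed
  have tail: "stein_sol a b c g x = - 1 / (stein_s x * kummer_density a b c x) *
      (LBINT t:{x<..}. kummer_density a b c t * g t)" for x
    by (simp add: set_integral_greaterThan_eq[OF u] centred stein_sol_eq[OF u] weighted_density_def)
  have "classical_solution a b c g (stein_sol a b c g)
      \<and> bounded (stein_sol a b c g ` {0<..})
      \<and> (\<forall>f. classical_solution a b c g f \<and> bounded (f ` {0<..}) \<longrightarrow>
            (\<forall>x>0. f x = stein_sol a b c g x))
      \<and> sup_norm (stein_sol a b c g) \<le> stein_M a b c * sup_norm g"
    if h: "continuous_on {0<..} h" and b: "1 - b - c \<le> 0"
  proof -
    have classical: "classical_solution a b c g (stein_sol a b c g)"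
      unfolding classical_solution_def
      using eq_at h by (simp add: continuous_on_eq_continuous_at)
    have "\<bar>g t\<bar> \<le> sup_norm g" if "0 < t" for t
      unfolding sup_norm_def using that g_bound by (intro cSUP_upper) (auto intro!: bdd_aboveI2)
    note bound = abs_stein_sol_le[OF assms(1,2) b u centred this]
    have "bounded (stein_sol a b c g ` {0<..})"
      unfolding bounded_iff using bound by auto
    moreover have "sup_norm (stein_sol a b c g) \<le> stein_M a b c * sup_norm g"
      unfolding sup_norm_def[of "stein_sol a b c g"] using bound by (intro cSUP_least) auto
    ultimately show ?thesis
      using classical bounded_solution_unique[OF assms(1,2) u classical] by blast
  qed
  moreover have "set_integrable lborel {0<..} (\<lambda>t. kummer_density a b c t * g t)"
    using u unfolding set_integrable_def by (intro integrable_mult_indicator) auto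
  ultimately show ?thesis
    using caratheodory_solution_stein_sol[OF assms(1,2) u g_bound] eq_at tail by blast
qed

end
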